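(* Let $(\Omega,\mathcal{H},\mathcal{E})$ be a sublinear expectation space and let $K$ be a subset of $L^1$. Then $K$ is uniformly integrable if and only if there is a nonnegative function $\varphi$ defined on $[0,\infty)$ such that $\lim_{t\to\infty}\varphi(t)/t=\infty$ and $\sup_{X\in K}\mathcal{E}[\varphi\circ|X|]<\infty$.
   Context: Let $(\Omega,\mathcal{F})$ be a given measurable space and $\mathcal{H}$ a linear space of $\mathcal{F}$-measurable real functions defined on $\Omega$ such that every constant $c$ belongs to $\mathcal{H}$, and if $X\in\mathcal{H}$ then $|X|\in\mathcal{H}$ and $XI_A\in\mathcal{H}$ for any $A\in\mathcal{F}$, where $I_A$ is the indicator function of $A$. A sublinear expectation $\mathcal{E}$ on $\mathcal{H}$ is a functional $\mathcal{E}:\mathcal{H}\to\mathbb{R}$ satisfying: (a) monotonicity: $\mathcal{E}[X]\ge\mathcal{E}[Y]$ if $X\ge Y$; (b) constant preserving: $\mathcal{E}[c]=c$ for all $c\in\mathbb{R}$; (c) sub-additivity: $\mathcal{E}[X+Y]\le\mathcal{E}[X]+\mathcal{E}[Y]$; (d) positive homogeneity: $\mathcal{E}[\lambda X]=\lambda\mathcal{E}[X]$ for all $\lambda\ge 0$. The triple $(\Omega,\mathcal{H},\mathcal{E})$ is called a sublinear expectation space. For $p\in[1,\infty)$, the map $\|\cdot\|_p: X\mapsto(\mathcal{E}[|X|^p])^{1/p}$ forms a seminorm on $\mathcal{H}$. The space $\mathcal{L}^p(\mathcal{F})$ is the completion under $\|\cdot\|_p$ of the set $\{X\in\mathcal{H}:\|X\|_p<\infty\}$,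 and $L^p=L^p(\mathcal{F})$ is the space of equivalence classes of $\mathcal{L}^p$ modulo equality in $\|\cdot\|_p$. A set $K\subset L^1$ is said to be uniformly integrable if $\lim_{c\to\infty}\sup_{X\in K}\mathcal{E}[I_{\{|X|\ge c\}}|X|]=0$. *)

theory Defs
  imports "HOL-Analysis.Analysis"
begin

text \<open>The measurable space \<open>(\<Omega>, \<F>)\<close> is \<open>(space M, sets M)\<close>; the measure carried by \<open>M\<close> plays no role.
  Functions on \<open>\<Omega>\<close> are total functions whose values outside \<open>space M\<close> are irrelevant; \<open>H_cong\<close>
  says exactly this.\<close>

locale sublinear_expectation_space =
  fixes M :: "'a measure" and H :: "('a \<Rightarrow> real) set" and E :: "('a \<Rightarrow> real) \<Rightarrow> real"
  assumes H_measurable: "H \<subseteq> borel_measurable M"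
    and H_cong: "\<And>X Y. X \<in> H \<Longrightarrow> (\<And>\<omega>. \<omega> \<in> space M \<Longrightarrow> Y \<omega> = X \<omega>) \<Longrightarrow> Y \<in> H"
    and H_const: "\<And>c. (\<lambda>\<omega>. c) \<in> H"
    and H_add: "\<And>X Y. X \<in> H \<Longrightarrow> Y \<in> H \<Longrightarrow> (\<lambda>\<omega>. X \<omega> + Y \<omega>) \<in> H"
    and H_scale: "\<And>a X. X \<in> H \<Longrightarrow> (\<lambda>\<omega>. a * X \<omega>) \<in> H"
    and H_abs: "\<And>X. X \<in> H \<Longrightarrow> (\<lambda>\<omega>. \<bar>X \<omega>\<bar>) \<in> H"
    and H_indicator: "\<And>X A. X \<in> H \<Longrightarrow> A \<in> sets M \<Longrightarrow> (\<lambda>\<omega>. X \<omega> * indicator A \<omega>) \<in> H"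
    and E_mono: "\<And>X Y. X \<in> H \<Longrightarrow> Y \<in> H \<Longrightarrow> (\<And>\<omega>. \<omega> \<in> space M \<Longrightarrow> Y \<omega> \<le> X \<omega>) \<Longrightarrow> E Y \<le> E X"
    and E_const: "\<And>c. E (\<lambda>\<omega>. c) = c"
    and E_subadd: "\<And>X Y. X \<in> H \<Longrightarrow> Y \<in> H \<Longrightarrow> E (\<lambda>\<omega>. X \<omega> + Y \<omega>) \<le> E X + E Y"
    and E_scale: "\<And>a X. X \<in> H \<Longrightarrow> 0 \<le> a \<Longrightarrow> E (\<lambda>\<omega>. a * X \<omega>) = a * E X"

text \<open>\<open>L\<^sup>1\<close> is the completion of \<open>H\<close> under the seminorm \<open>E \<bar>X\<bar>\<close> (finite on all of \<open>H\<close>, since \<open>E\<close> is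
  real-valued and \<open>H\<close> is closed under absolute values), modulo equality in that seminorm: Cauchy
  sequences in \<open>H\<close> modulo null sequences. As \<open>E\<close> is only finitely sub-additive, the elements of
  \<open>L\<^sup>1\<close> cannot in general be realised as functions on \<open>\<Omega>\<close>.\<close>

definition cauchy_seqs :: "('a \<Rightarrow> real) set \<Rightarrow> (('a \<Rightarrow> real) \<Rightarrow> real) \<Rightarrow> (nat \<Rightarrow> 'a \<Rightarrow> real) set" where
  "cauchy_seqs H E = {x. (\<forall>n. x n \<in> H) \<and>
     (\<forall>\<epsilon>>0. \<exists>N. \<forall>m\<ge>N. \<forall>n\<ge>N. E (\<lambda>\<omega>. \<bar>x m \<omega> - x n \<omega>\<bar>) < \<epsilon>)}"

definition L1_rel :: "('a \<Rightarrow> real) set \<Rightarrow> (('a \<Rightarrow> real) \<Rightarrow> real)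
    \<Rightarrow> ((nat \<Rightarrow> 'a \<Rightarrow> real) \<times> (nat \<Rightarrow> 'a \<Rightarrow> real)) set" where
  "L1_rel H E = {(x, y). x \<in> cauchy_seqs H E \<and> y \<in> cauchy_seqs H E \<and>
     (\<lambda>n. E (\<lambda>\<omega>. \<bar>x n \<omega> - y n \<omega>\<bar>)) \<longlonglongrightarrow> 0}"

definition L1 :: "('a \<Rightarrow> real) set \<Rightarrow> (('a \<Rightarrow> real) \<Rightarrow> real) \<Rightarrow> (nat \<Rightarrow> 'a \<Rightarrow> real) set set" where
  "L1 H E = cauchy_seqs H E // L1_rel H E"

definition L1_class :: "('a \<Rightarrow> real) set \<Rightarrow> (('a \<Rightarrow> real) \<Rightarrow> real) \<Rightarrow> ('a \<Rightarrow> real)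
    \<Rightarrow> (nat \<Rightarrow> 'a \<Rightarrow> real) set" where
  "L1_class H E X = L1_rel H E `` {\<lambda>n. X}"

text \<open>\<open>E[I\<^bsub>{|X| \<ge> c}\<^esub> |X|]\<close> for a representative \<open>x\<close> of \<open>X\<close>. Truncation at \<open>c\<close> is discontinuous, so the
  truncated sequence need not be Cauchy and the value depends on the representative; hence the limit
  superior here and the supremum over all representatives in \<open>uniformly_integrable\<close>. Different
  representatives only shift the level \<open>c\<close> by a constant factor, so the notion is independent of this choice, and
  it is the literal one for elements of \<open>H\<close>: see \<open>uniformly_integrable_L1_class_iff\<close> below.\<close>

definition tail_expectation :: "'a measure \<Rightarrow> (('a \<Rightarrow> real) \<Rightarrow> real) \<Rightarrow> real
    \<Rightarrow> (nat \<Rightarrow> 'a \<Rightarrow> real) \<Rightarrow> ennreal" where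
  "tail_expectation M E c x =
     limsup (\<lambda>n. ennreal (E (\<lambda>\<omega>. \<bar>x n \<omega>\<bar> * indicator {\<omega> \<in> space M. \<bar>x n \<omega>\<bar> \<ge> c} \<omega>)))"

definition uniformly_integrable :: "'a measure \<Rightarrow> (('a \<Rightarrow> real) \<Rightarrow> real)
    \<Rightarrow> (nat \<Rightarrow> 'a \<Rightarrow> real) set set \<Rightarrow> bool" where
  "uniformly_integrable M E K \<longleftrightarrow>
     ((\<lambda>c. SUP X\<in>K. SUP x\<in>X. tail_expectation M E c x) \<longlongrightarrow> 0) at_top"

text \<open>\<open>E[\<phi> \<circ> |X|]\<close> for \<open>X \<in> L\<^sup>1\<close> and \<open>\<phi> \<ge> 0\<close>. The composition is formed on a representative and must
  again be an element of \<open>L\<^sup>1\<close>, on which \<open>E\<close> is defined by continuity. Since \<open>\<phi> \<circ> |X|\<close> does not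
  respect equality in the seminorm, the infimum over the admissible representatives is taken; it is
  \<open>\<infinity>\<close> if there are none, i.e. if \<open>\<phi> \<circ> |X|\<close> is not in \<open>L\<^sup>1\<close>.\<close>

definition comp_abs :: "(real \<Rightarrow> real) \<Rightarrow> (nat \<Rightarrow> 'a \<Rightarrow> real) \<Rightarrow> nat \<Rightarrow> 'a \<Rightarrow> real" where
  "comp_abs \<phi> x = (\<lambda>n \<omega>. \<phi> \<bar>x n \<omega>\<bar>)"

definition expectation_comp :: "('a \<Rightarrow> real) set \<Rightarrow> (('a \<Rightarrow> real) \<Rightarrow> real) \<Rightarrow> (real \<Rightarrow> real)
    \<Rightarrow> (nat \<Rightarrow> 'a \<Rightarrow> real) set \<Rightarrow> ennreal" where
  "expectation_comp H E \<phi> X =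
     (INF x\<in>{x \<in> X. comp_abs \<phi> x \<in> cauchy_seqs H E}. ennreal (lim (\<lambda>n. E (comp_abs \<phi> x n))))"

context sublinear_expectation_space
begin

lemma H_diff: "X \<in> H \<Longrightarrow> Y \<in> H \<Longrightarrow> (\<lambda>\<omega>. X \<omega> - Y \<omega>) \<in> H"
  using H_add[of X "\<lambda>\<omega>. (-1) * Y \<omega>"] H_scale[of Y "-1"] by simp

lemma const_seq_cauchy: "X \<in> H \<Longrightarrow> (\<lambda>n. X) \<in> cauchy_seqs H E"
  by (simp add: cauchy_seqs_def E_const)

lemma const_seq_in_L1_class: "X \<in> H \<Longrightarrow> (\<lambda>n. X) \<in> L1_class H E X"
  by (simp add: L1_class_def L1_rel_def const_seq_cauchy E_const)

lemma L1_class_in_L1: "X \<in> H \<Longrightarrow> L1_class H E X \<in> L1 H E"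
  by (simp add: L1_class_def L1_def const_seq_cauchy quotientI)

lemma expectation_comp_L1_class_le:
  assumes "X \<in> H" "(\<lambda>\<omega>. \<phi> \<bar>X \<omega>\<bar>) \<in> H"
  shows "expectation_comp H E \<phi> (L1_class H E X) \<le> ennreal (E (\<lambda>\<omega>. \<phi> \<bar>X \<omega>\<bar>))"
  unfolding expectation_comp_def
  by (rule INF_lower2[of "\<lambda>n. X"])
     (use assms in \<open>auto simp: const_seq_in_L1_class comp_abs_def const_seq_cauchy\<close>)

lemma H_tail:
  assumes "X \<in> H"
  shows "(\<lambda>\<omega>. \<bar>X \<omega>\<bar> * indicator {\<omega> \<in> space M. \<bar>X \<omega>\<bar> \<ge> c} \<omega>) \<in> H"
proof -
  have [measurable]: "X \<in> borel_measurable M"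
    using assms H_measurable by blast
  have "{\<omega> \<in> space M. \<bar>X \<omega>\<bar> \<ge> c} \<in> sets M"
    by measurable
  then show ?thesis
    using H_indicator H_abs assms by blast
qed

lemma tail_perturb:
  assumes X: "X \<in> H" and Y: "Y \<in> H" and c: "c > 0"
  shows "E (\<lambda>\<omega>. \<bar>Y \<omega>\<bar> * indicator {\<omega> \<in> space M. \<bar>Y \<omega>\<bar> \<ge> 2 * c} \<omega>) \<le>
     2 * E (\<lambda>\<omega>. \<bar>X \<omega>\<bar> * indicator {\<omega> \<in> space M. \<bar>X \<omega>\<bar> \<ge> c} \<omega>) + 2 * E (\<lambda>\<omega>. \<bar>X \<omega> - Y \<omega>\<bar>)"
    (is "E ?L \<le> 2 * E ?R + 2 * E ?D")
proof -
  have R: "?R \<in> H" and L: "?L \<in> H" and D: "?D \<in> H"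
    using X Y by (auto intro: H_tail H_abs H_diff)
  have "E ?L \<le> E (\<lambda>\<omega>. 2 * ?R \<omega> + 2 * ?D \<omega>)"
  proof (rule E_mono[OF H_add[OF H_scale[OF R] H_scale[OF D]] L])
    fix \<omega> assume "\<omega> \<in> space M"
    then show "?L \<omega> \<le> 2 * ?R \<omega> + 2 * ?D \<omega>"
      using c abs_triangle_ineq2[of "Y \<omega>" "X \<omega>"] abs_minus_commute[of "X \<omega>" "Y \<omega>"]
      by (cases "c \<le> \<bar>X \<omega>\<bar>"; cases "2 * c \<le> \<bar>Y \<omega>\<bar>") auto
  qed
  also have "\<dots> \<le> E (\<lambda>\<omega>. 2 * ?R \<omega>) + E (\<lambda>\<omega>. 2 * ?D \<omega>)"
    by (rule E_subadd[OF H_scale[OF R] H_scale[OF D]])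
  also have "\<dots> = 2 * E ?R + 2 * E ?D"
    by (simp add: E_scale R D)
  finally show ?thesis .
qed

lemma E_nonneg: "X \<in> H \<Longrightarrow> (\<And>\<omega>. 0 \<le> X \<omega>) \<Longrightarrow> 0 \<le> E X"
  using E_mono[OF _ H_const[of 0], of X] by (simp add: E_const)

lemma tail_expectation_L1_class_le:
  assumes X: "X \<in> H" and x: "x \<in> L1_class H E X" and c: "c > 0"
  shows "tail_expectation M E (2 * c) x \<le>
     2 * ennreal (E (\<lambda>\<omega>. \<bar>X \<omega>\<bar> * indicator {\<omega> \<in> space M. \<bar>X \<omega>\<bar> \<ge> c} \<omega>))" (is "_ \<le> 2 * ennreal ?R")
proof -
  have xH: "\<And>n. x n \<in> H" and lim: "(\<lambda>n. E (\<lambda>\<omega>. \<bar>X \<omega> - x n \<omega>\<bar>)) \<longlonglongrightarrow> 0"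
    using x by (auto simp: L1_class_def L1_rel_def cauchy_seqs_def)
  have R0: "0 \<le> ?R"
    by (rule E_nonneg) (auto intro: H_tail X)
  have "(\<lambda>n. ennreal (2 * ?R + 2 * E (\<lambda>\<omega>. \<bar>X \<omega> - x n \<omega>\<bar>))) \<longlonglongrightarrow> ennreal (2 * ?R + 2 * 0)"
    by (intro tendsto_intros tendsto_ennrealI lim)
  then have "limsup (\<lambda>n. ennreal (2 * ?R + 2 * E (\<lambda>\<omega>. \<bar>X \<omega> - x n \<omega>\<bar>))) = ennreal (2 * ?R)"
    using lim_imp_Limsup[OF sequentially_bot] by fastforce
  moreover have "tail_expectation M E (2 * c) x \<le>
      limsup (\<lambda>n. ennreal (2 * ?R + 2 * E (\<lambda>\<omega>. \<bar>X \<omega> - x n \<omega>\<bar>)))"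
    unfolding tail_expectation_def
    by (intro Limsup_mono always_eventually allI ennreal_leI tail_perturb X xH c)
  ultimately show ?thesis
    using R0 by (simp add: ennreal_mult)
qed

theorem uniformly_integrable_L1_class_iff:
  assumes K: "K \<subseteq> H"
  shows "uniformly_integrable M E (L1_class H E ` K) \<longleftrightarrow>
     ((\<lambda>c. SUP X\<in>K. ennreal (E (\<lambda>\<omega>. \<bar>X \<omega>\<bar> * indicator {\<omega> \<in> space M. \<bar>X \<omega>\<bar> \<ge> c} \<omega>))) \<longlongrightarrow> 0) at_top"
    (is "_ \<longleftrightarrow> (?g \<longlongrightarrow> 0) at_top")
proof -
  define f where "f c = (SUP X\<in>L1_class H E ` K. SUP x\<in>X. tail_expectation M E c x)" for c
  have gf: "?g c \<le> f c" for c
  proof (rule SUP_least)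
    fix X assume "X \<in> K"
    then have "(\<lambda>n. X) \<in> L1_class H E X" and XK: "L1_class H E X \<in> L1_class H E ` K"
      using K const_seq_in_L1_class by auto
    then have "tail_expectation M E c (\<lambda>n. X) \<le> (SUP x\<in>L1_class H E X. tail_expectation M E c x)"
      by (intro SUP_upper)
    also have "\<dots> \<le> f c"
      unfolding f_def by (rule SUP_upper[OF XK])
    finally show "ennreal (E (\<lambda>\<omega>. \<bar>X \<omega>\<bar> * indicator {\<omega> \<in> space M. \<bar>X \<omega>\<bar> \<ge> c} \<omega>)) \<le> f c"
      by (simp add: tail_expectation_def Limsup_const)
  qed
  have fg: "f c \<le> 2 * ?g (c / 2)" if "c > 0" for c
    unfolding f_def
  proof (intro SUP_least)
    fix C x assume "C \<in> L1_class H E ` K" "x \<in> C"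
    then obtain X where X: "X \<in> K" "x \<in> L1_class H E X" by auto
    have "tail_expectation M E c x \<le>
        2 * ennreal (E (\<lambda>\<omega>. \<bar>X \<omega>\<bar> * indicator {\<omega> \<in> space M. \<bar>X \<omega>\<bar> \<ge> c / 2} \<omega>))"
      using tail_expectation_L1_class_le[of X x "c / 2"] X K that by auto
    also have "\<dots> \<le> 2 * ?g (c / 2)"
      by (intro mult_left_mono SUP_upper X) simp
    finally show "tail_expectation M E c x \<le> 2 * ?g (c / 2)" .
  qed
  have "(f \<longlongrightarrow> 0) at_top" if g: "(?g \<longlongrightarrow> 0) at_top"
  proof (rule tendsto_sandwich[OF _ _ tendsto_const])
    have "filterlim (\<lambda>c::real. c / 2) at_top at_top"
      using filterlim_tendsto_pos_mult_at_top[OF tendsto_const[of "1/2"] _ filterlim_ident] by simp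
    then have "((\<lambda>c. ?g (c / 2)) \<longlongrightarrow> 0) at_top"
      by (rule filterlim_compose[OF g])
    then show "((\<lambda>c. 2 * ?g (c / 2)) \<longlongrightarrow> 0) at_top"
      using ennreal_tendsto_cmult[of 2 "\<lambda>c. ?g (c / 2)" 0] by simp
    show "\<forall>\<^sub>F c in at_top. f c \<le> 2 * ?g (c / 2)"
      using eventually_gt_at_top[of 0] by eventually_elim (rule fg)
  qed simp
  moreover have "(?g \<longlongrightarrow> 0) at_top" if "(f \<longlongrightarrow> 0) at_top"
    by (rule tendsto_sandwich[OF _ _ tendsto_const that]) (auto simp: gf)
  ultimately show ?thesis
    unfolding uniformly_integrable_def f_def[symmetric] by blast
qed

end

end

theory Submission
  imports Defs
begin

text \<open>If \<open>\<phi>(t) / t \<rightarrow> \<infinity>\<close>, then \<open>|x| I\<^bsub>{|x| \<ge> c}\<^esub> \<le> \<delta> \<phi>(|x|)\<close> for large \<open>c\<close>, and \<open>tail_perturb\<close>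
  carries the resulting bound from one representative to all of them. Conversely, choose levels
  \<open>c\<^sub>k \<up> \<infinity>\<close> at which the tails are below \<open>2\<^sup>-\<^sup>k\<close> uniformly on \<open>K\<close> and put
  \<open>\<phi>(t) = \<Sum>\<^sub>k (t - c\<^sub>k)\<^sup>+\<close>. As \<open>H\<close> need not be closed under \<open>\<phi>\<close>, one passes to the representative
  consisting of the \<open>c\<^sub>n\<close>-truncations of a suitable subsequence: on the \<open>n\<close>-th
  term only the first \<open>n\<close> summands of \<open>\<phi>\<close> are non-zero.\<close>

section \<open>Truncation and a piecewise linear function of superlinear growth\<close>

definition trunc :: "real \<Rightarrow> real \<Rightarrow> real" where
  "trunc b t = max (- b) (min t b)"

lemma abs_trunc_le: "0 \<le> b \<Longrightarrow> \<bar>trunc b t\<bar> \<le> b"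
  by (auto simp: trunc_def)

lemma abs_trunc_le_abs: "0 \<le> b \<Longrightarrow> \<bar>trunc b t\<bar> \<le> \<bar>t\<bar>"
  by (auto simp: trunc_def)

text \<open>Clamping, unlike multiplication by an indicator, leaves an error that is itself a ramp,
  and ramps are what the choice of levels controls.\<close>

lemma abs_diff_trunc: "0 \<le> b \<Longrightarrow> \<bar>t - trunc b t\<bar> = max 0 (\<bar>t\<bar> - b)"
  by (auto simp: trunc_def)

text \<open>A convex function whose slope at \<open>t\<close> counts the levels below
  \<open>t\<close>, provided the levels are monotone and unbounded. At each point the series then
  has only finitely many non-zero terms.\<close>

definition ramp_sum :: "(nat \<Rightarrow> real) \<Rightarrow> real \<Rightarrow> real" where
  "ramp_sum c t = (\<Sum>k. max 0 (t - c k))"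

lemma ramp_sum_eq:
  assumes "mono c" "t \<le> c n"
  shows "ramp_sum c t = (\<Sum>k<n. max 0 (t - c k))"
  unfolding ramp_sum_def
proof (rule suminf_finite)
  fix k assume "k \<notin> {..<n}"
  then have "c n \<le> c k" using monoD[OF assms(1)] by simp
  then show "max 0 (t - c k) = 0" using assms(2) by simp
qed simp

lemma ramp_sum_ge:
  assumes c: "mono c" "\<And>k. real k \<le> c k"
  shows "(\<Sum>k<n. max 0 (t - c k)) \<le> ramp_sum c t"
proof -
  \<comment> \<open>The hypothesis \<open>real k \<le> c k\<close> forces some level above
    \<open>t\<close>, so that the series is a finite sum; \<open>m\<close> also exceeds
    \<open>n\<close>.\<close>
  define m where "m = max n (nat \<lceil>t\<rceil>)"
  have "t \<le> real m" unfolding m_def by linarith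
  then have "t \<le> c m" using c(2)[of m] by linarith
  then have "ramp_sum c t = (\<Sum>k<m. max 0 (t - c k))" by (rule ramp_sum_eq[OF c(1)])
  moreover have "(\<Sum>k<n. max 0 (t - c k)) \<le> (\<Sum>k<m. max 0 (t - c k))"
    by (rule sum_mono2) (auto simp: m_def)
  ultimately show ?thesis by simp
qed

text \<open>Beyond twice the level \<open>c n\<close>, each of the first \<open>n\<close> ramps is
  at least \<open>t / 2\<close>, so the quotient is at least \<open>n / 2\<close>.\<close>

lemma ramp_sum_superlinear:
  assumes c: "mono c" "\<And>k. real k \<le> c k"
  shows "filterlim (\<lambda>t. ramp_sum c t / t) at_top at_top"
  unfolding filterlim_at_top
proof
  fix Z :: real
  obtain n :: nat where n: "2 * Z \<le> real n" using real_arch_simple by blast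
  have "Z \<le> ramp_sum c t / t" if t: "t \<ge> 1" "t \<ge> 2 * c n" for t
  proof -
    have "Z * t \<le> real n * (t / 2)" using n t mult_right_mono[of "2 * Z" "real n" t] by simp
    also have "\<dots> = (\<Sum>k<n. t / 2)" by simp
    also have "\<dots> \<le> (\<Sum>k<n. max 0 (t - c k))"
    proof (rule sum_mono)
      fix k assume "k \<in> {..<n}"
      then have "c k \<le> c n" using monoD[OF c(1)] by simp
      then show "t / 2 \<le> max 0 (t - c k)" using t by linarith
    qed
    also have "\<dots> \<le> ramp_sum c t" by (rule ramp_sum_ge[OF c])
    finally show ?thesis using t by (simp add: field_simps)
  qed
  then show "\<forall>\<^sub>F t in at_top. Z \<le> ramp_sum c t / t"
    unfolding eventually_at_top_linorder by (meson max.bounded_iff)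
qed

lemma sum_lessThan_add:
  fixes f :: "nat \<Rightarrow> 'b::comm_monoid_add"
  shows "(\<Sum>k<j + l. f k) = (\<Sum>k<j. f k) + (\<Sum>k<l. f (k + j))"
  by (induction l) (simp_all add: ac_simps)

lemma sum_half_powers_le: "finite A \<Longrightarrow> (\<Sum>k\<in>A. (1 / 2 :: real) ^ k) \<le> 2"
  using sum_le_suminf[of "\<lambda>k. (1 / 2 :: real) ^ k" A] suminf_geometric[of "1 / 2 :: real"]
  by (simp add: summable_geometric)

section \<open>Lattice operations in \<open>H\<close> and continuity of \<open>E\<close> in the
  seminorm\<close>

context sublinear_expectation_space
begin

text \<open>The positive part is half of \<open>X + \<bar>X\<bar>\<close>. Closure under absolute
  values thus makes \<open>H\<close> a vector lattice, which contains ramps and truncations of its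
  elements.\<close>

lemma H_max0: "X \<in> H \<Longrightarrow> (\<lambda>\<omega>. max 0 (X \<omega>)) \<in> H"
  by (rule H_cong[OF H_scale[OF H_add[OF _ H_abs], of _ _ "1 / 2"]]) (auto simp: max_def)

lemma H_trunc: assumes X: "X \<in> H" shows "(\<lambda>\<omega>. trunc b (X \<omega>)) \<in> H"
proof -
  \<comment> \<open>Both halves of the clamp are positive parts: \<open>min t b\<close> is
    \<open>b - max 0 (b - t)\<close>, and \<open>max (- b) s\<close> is
    \<open>max 0 (s + b) - b\<close>.\<close>
  have "(\<lambda>\<omega>. b - max 0 (b - X \<omega>)) \<in> H"
    by (intro H_diff H_max0 H_const X)
  then have "(\<lambda>\<omega>. max 0 (b - max 0 (b - X \<omega>) + b) + (- b)) \<in> H"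
    by (intro H_add H_max0 H_const)
  then show ?thesis
    by (rule H_cong) (auto simp: trunc_def)
qed

lemma H_sum: "(\<And>i. i \<in> I \<Longrightarrow> X i \<in> H) \<Longrightarrow> (\<lambda>\<omega>. \<Sum>i\<in>I. X i \<omega>) \<in> H"
  by (induction I rule: infinite_finite_induct) (auto intro: H_const H_add)

lemma E_sum_le: "(\<And>i. i \<in> I \<Longrightarrow> X i \<in> H) \<Longrightarrow> E (\<lambda>\<omega>. \<Sum>i\<in>I. X i \<omega>) \<le> (\<Sum>i\<in>I. E (X i))"
proof (induction I rule: infinite_finite_induct)
  case (insert i I)
  have "E (\<lambda>\<omega>. X i \<omega> + (\<Sum>i\<in>I. X i \<omega>)) \<le> E (X i) + E (\<lambda>\<omega>. \<Sum>i\<in>I. X i \<omega>)"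
    by (intro E_subadd H_sum) (auto intro: insert.prems)
  with insert show ?case by fastforce
qed (auto simp: E_const)

lemma E_abs_diff_triangle:
  assumes "X \<in> H" "Y \<in> H" "Z \<in> H"
  shows "E (\<lambda>\<omega>. \<bar>X \<omega> - Z \<omega>\<bar>) \<le> E (\<lambda>\<omega>. \<bar>X \<omega> - Y \<omega>\<bar>) + E (\<lambda>\<omega>. \<bar>Y \<omega> - Z \<omega>\<bar>)"
proof -
  have "E (\<lambda>\<omega>. \<bar>X \<omega> - Z \<omega>\<bar>) \<le> E (\<lambda>\<omega>. \<bar>X \<omega> - Y \<omega>\<bar> + \<bar>Y \<omega> - Z \<omega>\<bar>)"
    by (intro E_mono H_add H_abs H_diff assms) auto
  also have "\<dots> \<le> E (\<lambda>\<omega>. \<bar>X \<omega> - Y \<omega>\<bar>) + E (\<lambda>\<omega>. \<bar>Y \<omega> - Z \<omega>\<bar>)"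
    by (intro E_subadd H_abs H_diff assms)
  finally show ?thesis .
qed

text \<open>Monotonicity and sub-additivity applied to \<open>X \<le> Y + \<bar>X - Y\<bar>\<close>,
  then with the roles exchanged.\<close>

lemma E_diff_le:
  assumes "X \<in> H" "Y \<in> H"
  shows "\<bar>E X - E Y\<bar> \<le> E (\<lambda>\<omega>. \<bar>X \<omega> - Y \<omega>\<bar>)"
proof -
  have *: "E X - E Y \<le> E (\<lambda>\<omega>. \<bar>X \<omega> - Y \<omega>\<bar>)" if "X \<in> H" "Y \<in> H" for X Y
  proof -
    have "E X \<le> E (\<lambda>\<omega>. Y \<omega> + \<bar>X \<omega> - Y \<omega>\<bar>)"
      by (intro E_mono H_add H_abs H_diff that) auto
    also have "\<dots> \<le> E Y + E (\<lambda>\<omega>. \<bar>X \<omega> - Y \<omega>\<bar>)"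
      by (intro E_subadd H_abs H_diff that)
    finally show ?thesis by simp
  qed
  from *[OF assms] *[OF assms(2,1)] show ?thesis
    by (simp add: abs_minus_commute)
qed

text \<open>This makes the \<open>lim\<close> in \<open>expectation_comp\<close> a genuine
  limit.\<close>

lemma cauchy_seqs_imp_convergent:
  assumes "x \<in> cauchy_seqs H E"
  shows "convergent (\<lambda>n. E (x n))"
proof -
  have "Cauchy (\<lambda>n. E (x n))"
  proof (rule CauchyI)
    fix e :: real assume "0 < e"
    then obtain N where N: "\<And>m n. m \<ge> N \<Longrightarrow> n \<ge> N \<Longrightarrow> E (\<lambda>\<omega>. \<bar>x m \<omega> - x n \<omega>\<bar>) < e"
      using assms unfolding cauchy_seqs_def by blast
    have "norm (E (x m) - E (x n)) < e" if "m \<ge> N" "n \<ge> N" for m n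
      using N[OF that] E_diff_le[of "x m" "x n"] assms by (auto simp: cauchy_seqs_def)
    then show "\<exists>N. \<forall>m\<ge>N. \<forall>n\<ge>N. norm (E (x m) - E (x n)) < e" by blast
  qed
  then show ?thesis by (simp add: Cauchy_convergent_iff)
qed

text \<open>The ramp is Lipschitz in \<open>X\<close>, whereas the tail jumps at the level
  \<open>c\<close>; the estimates on Cauchy sequences below are made with the ramp.\<close>

lemma E_ramp_le_tail:
  assumes "X \<in> H" "0 \<le> c"
  shows "E (\<lambda>\<omega>. max 0 (\<bar>X \<omega>\<bar> - c)) \<le>
    E (\<lambda>\<omega>. \<bar>X \<omega>\<bar> * indicator {\<omega> \<in> space M. \<bar>X \<omega>\<bar> \<ge> c} \<omega>)"
  by (rule E_mono[OF H_tail[OF assms(1)] H_max0[OF H_diff[OF H_abs[OF assms(1)] H_const]]])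
    (use assms(2) in \<open>auto simp: indicator_def\<close>)

lemma L1_elements_equivalent:
  assumes "X \<in> L1 H E" "x \<in> X" "y \<in> X"
  shows "x \<in> cauchy_seqs H E" "y \<in> cauchy_seqs H E"
    and "(\<lambda>n. E (\<lambda>\<omega>. \<bar>x n \<omega> - y n \<omega>\<bar>)) \<longlonglongrightarrow> 0"
proof -
  obtain z where z: "X = L1_rel H E `` {z}"
    using assms(1) by (auto simp: L1_def quotient_def)
  show x: "x \<in> cauchy_seqs H E" and y: "y \<in> cauchy_seqs H E"
    using assms z by (auto simp: L1_rel_def)
  have zx: "(\<lambda>n. E (\<lambda>\<omega>. \<bar>z n \<omega> - x n \<omega>\<bar>)) \<longlonglongrightarrow> 0" and
    zy: "(\<lambda>n. E (\<lambda>\<omega>. \<bar>z n \<omega> - y n \<omega>\<bar>)) \<longlonglongrightarrow> 0" and zc: "z \<in> cauchy_seqs H E"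
    using assms z by (auto simp: L1_rel_def)
  have H: "x n \<in> H" "y n \<in> H" "z n \<in> H" for n
    using x y zc by (auto simp: cauchy_seqs_def)
  show "(\<lambda>n. E (\<lambda>\<omega>. \<bar>x n \<omega> - y n \<omega>\<bar>)) \<longlonglongrightarrow> 0"
  proof (rule tendsto_sandwich[OF _ _ tendsto_const tendsto_add_zero[OF zx zy]])
    show "\<forall>\<^sub>F n in sequentially. E (\<lambda>\<omega>. \<bar>x n \<omega> - y n \<omega>\<bar>) \<le>
        E (\<lambda>\<omega>. \<bar>z n \<omega> - x n \<omega>\<bar>) + E (\<lambda>\<omega>. \<bar>z n \<omega> - y n \<omega>\<bar>)"
    proof (intro always_eventually allI)
      fix n show "E (\<lambda>\<omega>. \<bar>x n \<omega> - y n \<omega>\<bar>) \<le>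
          E (\<lambda>\<omega>. \<bar>z n \<omega> - x n \<omega>\<bar>) + E (\<lambda>\<omega>. \<bar>z n \<omega> - y n \<omega>\<bar>)"
        using E_abs_diff_triangle[of "x n" "z n" "y n"] H by (simp add: abs_minus_commute)
    qed
    show "\<forall>\<^sub>F n in sequentially. 0 \<le> E (\<lambda>\<omega>. \<bar>x n \<omega> - y n \<omega>\<bar>)"
      by (intro always_eventually allI E_nonneg H_abs H_diff H) simp
  qed
qed

section \<open>Sufficiency: superlinear growth implies uniform integrability\<close>

text \<open>Here \<open>x\<close> is admissible for \<open>\<phi>\<close> while \<open>y\<close> is
  arbitrary. The tail of \<open>x\<close> at level \<open>c / 2\<close> is bounded through
  \<open>\<phi>\<close>, and \<open>tail_perturb\<close> passes to \<open>y\<close> at level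
  \<open>c\<close>, at the cost of a factor 2 and of a seminorm distance that vanishes in the
  limit.\<close>

lemma tail_expectation_le:
  assumes X: "X \<in> L1 H E" "x \<in> X" "y \<in> X"
    and \<phi>x: "comp_abs \<phi> x \<in> cauchy_seqs H E"
    and L: "lim (\<lambda>n. E (comp_abs \<phi> x n)) \<le> B"
    and \<delta>: "0 \<le> \<delta>" and c: "0 < c"
    and \<phi>: "\<And>t. 0 \<le> t \<Longrightarrow> 0 \<le> \<phi> t" "\<And>t. c / 2 \<le> t \<Longrightarrow> t \<le> \<delta> * \<phi> t"
  shows "tail_expectation M E c y \<le> ennreal (2 * (\<delta> * B))"
proof -
  define L where "L = lim (\<lambda>n. E (comp_abs \<phi> x n))"
  let ?d = "\<lambda>n. E (\<lambda>\<omega>. \<bar>x n \<omega> - y n \<omega>\<bar>)"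
  have lim: "(\<lambda>n. E (comp_abs \<phi> x n)) \<longlonglongrightarrow> L"
    unfolding L_def using cauchy_seqs_imp_convergent[OF \<phi>x] by (simp add: convergent_LIMSEQ_iff)
  note eq = L1_elements_equivalent[OF X]
  have H: "x n \<in> H" "y n \<in> H" "comp_abs \<phi> x n \<in> H" for n
    using eq(1,2) \<phi>x by (auto simp: cauchy_seqs_def)
  have le: "E (\<lambda>\<omega>. \<bar>y n \<omega>\<bar> * indicator {\<omega> \<in> space M. \<bar>y n \<omega>\<bar> \<ge> c} \<omega>) \<le>
      2 * (\<delta> * E (comp_abs \<phi> x n)) + 2 * ?d n" for n
  proof -
    have "E (\<lambda>\<omega>. \<bar>x n \<omega>\<bar> * indicator {\<omega> \<in> space M. \<bar>x n \<omega>\<bar> \<ge> c / 2} \<omega>) \<le>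
        E (\<lambda>\<omega>. \<delta> * comp_abs \<phi> x n \<omega>)"
      by (rule E_mono[OF H_scale[OF H(3)] H_tail[OF H(1)]])
        (use \<phi> \<delta> in \<open>auto simp: indicator_def comp_abs_def\<close>)
    also have "\<dots> = \<delta> * E (comp_abs \<phi> x n)"
      by (rule E_scale[OF H(3) \<delta>])
    finally show ?thesis
      using tail_perturb[OF H(1,2), of "c / 2" n n] c by simp
  qed
  have "(\<lambda>n. ennreal (2 * (\<delta> * E (comp_abs \<phi> x n)) + 2 * ?d n)) \<longlonglongrightarrow> ennreal (2 * (\<delta> * L) + 2 * 0)"
    by (intro tendsto_intros tendsto_ennrealI lim eq(3))
  then have "limsup (\<lambda>n. ennreal (2 * (\<delta> * E (comp_abs \<phi> x n)) + 2 * ?d n)) = ennreal (2 * (\<delta> * L))"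
    using lim_imp_Limsup[OF sequentially_bot] by fastforce
  moreover have "tail_expectation M E c y \<le>
      limsup (\<lambda>n. ennreal (2 * (\<delta> * E (comp_abs \<phi> x n)) + 2 * ?d n))"
    unfolding tail_expectation_def
    by (intro Limsup_mono always_eventually allI ennreal_leI le)
  moreover have "2 * (\<delta> * L) \<le> 2 * (\<delta> * B)"
    using L \<delta> by (simp add: L_def mult_left_mono)
  ultimately show ?thesis
    using ennreal_leI order_trans by metis
qed

lemma uniformly_integrableI:
  assumes K: "K \<subseteq> L1 H E"
    and \<phi>: "\<And>t. 0 \<le> t \<Longrightarrow> 0 \<le> \<phi> t" "filterlim (\<lambda>t. \<phi> t / t) at_top at_top"
    and sup: "(SUP X\<in>K. expectation_comp H E \<phi> X) < \<infinity>"
  shows "uniformly_integrable M E K"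
  unfolding uniformly_integrable_def
proof (rule order_tendstoI)
  fix a :: ennreal assume "0 < a"
  \<comment> \<open>The bound \<open>a\<close> may be infinite; density yields a positive real
    \<open>r\<close> below it.\<close>
  then obtain b where "0 < b" "b < a" using dense by blast
  then obtain r where r: "0 < r" "ennreal r < a"
    by (cases b) (auto simp: ennreal_less_zero_iff)
  obtain s where s: "0 \<le> s" "(SUP X\<in>K. expectation_comp H E \<phi> X) = ennreal s"
    using sup by (cases "SUP X\<in>K. expectation_comp H E \<phi> X") auto
  \<comment> \<open>Strictly above the supremum, so that every infimum in
    \<open>expectation_comp\<close> is undercut by some representative; positive, so that division
    by \<open>B\<close> is safe.\<close>
  define B where "B = s + 1"
  have B: "0 < B" "ennreal s < ennreal B" using s by (auto simp: B_def ennreal_less_iff)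
  define \<delta> where "\<delta> = r / (2 * B)"
  have \<delta>: "0 < \<delta>" "2 * (\<delta> * B) = r" using r B by (auto simp: \<delta>_def)
  obtain T where T: "\<And>t. t \<ge> T \<Longrightarrow> 1 / \<delta> \<le> \<phi> t / t"
    using \<phi>(2) unfolding filterlim_at_top eventually_at_top_linorder by blast
  \<comment> \<open>The level is at least \<open>2 * T\<close> because growth of
    \<open>\<phi>\<close> is needed from \<open>c / 2\<close> on.\<close>
  have bound: "(SUP X\<in>K. SUP y\<in>X. tail_expectation M E c y) \<le> ennreal r"
    if c: "0 < c" "2 * T \<le> c" for c
  proof (intro SUP_least)
    fix X y assume X: "X \<in> K" "y \<in> X"
    have "expectation_comp H E \<phi> X \<le> ennreal s"
      unfolding s(2)[symmetric] by (rule SUP_upper[OF X(1)])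
    then have "expectation_comp H E \<phi> X < ennreal B" using B(2) by (rule le_less_trans)
    then obtain x where x: "x \<in> X" "comp_abs \<phi> x \<in> cauchy_seqs H E"
      "ennreal (lim (\<lambda>n. E (comp_abs \<phi> x n))) < ennreal B"
      unfolding expectation_comp_def INF_less_iff by auto
    have "lim (\<lambda>n. E (comp_abs \<phi> x n)) \<le> B"
      using x(3) B(1) by (meson ennreal_leI leD linear)
    then have "tail_expectation M E c y \<le> ennreal (2 * (\<delta> * B))"
      using \<delta>(1)
    proof (intro tail_expectation_le[OF _ x(1) X(2) x(2)])
      fix t assume "c / 2 \<le> t"
      then have "1 / \<delta> \<le> \<phi> t / t" "0 < t" using T c by auto
      then show "t \<le> \<delta> * \<phi> t" using \<delta>(1) by (simp add: field_simps)
    qed (use X K \<delta> c \<phi>(1) in auto)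
    then show "tail_expectation M E c y \<le> ennreal r" by (simp only: \<delta>(2))
  qed
  show "\<forall>\<^sub>F c in at_top. (SUP X\<in>K. SUP y\<in>X. tail_expectation M E c y) < a"
    using eventually_gt_at_top[of 0] eventually_ge_at_top[of "2 * T"]
    by eventually_elim (use bound r in \<open>auto intro: le_less_trans\<close>)
qed simp

section \<open>Necessity: construction of the levels and of an admissible representative\<close>

lemma uniformly_integrable_levels:
  assumes "uniformly_integrable M E K"
  obtains c :: "nat \<Rightarrow> real" where "mono c" "\<And>k. real k \<le> c k"
    "\<And>k X x. X \<in> K \<Longrightarrow> x \<in> X \<Longrightarrow> tail_expectation M E (c k) x < ennreal ((1 / 2) ^ k)"
proof -
  let ?f = "\<lambda>c. SUP X\<in>K. SUP x\<in>X. tail_expectation M E c x"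
  have "\<forall>\<^sub>F c in at_top. ?f c < ennreal ((1 / 2) ^ k)" for k :: nat
    using order_tendstoD(2)[OF assms[unfolded uniformly_integrable_def]] by simp
  then have "\<forall>k::nat. \<exists>d. \<forall>c\<ge>d. ?f c < ennreal ((1 / 2) ^ k)"
    unfolding eventually_at_top_linorder by blast
  then obtain d :: "nat \<Rightarrow> real" where d: "\<And>k c. c \<ge> d k \<Longrightarrow> ?f c < ennreal ((1 / 2) ^ k)"
    by metis
  \<comment> \<open>Summing the absolute thresholds makes \<open>c\<close> monotone and keeps
    \<open>c k\<close> above \<open>d k\<close>; the summand \<open>real k\<close> makes it
    unbounded.\<close>
  define c where "c k = real k + (\<Sum>i\<le>k. \<bar>d i\<bar>)" for k
  have "d k \<le> c k" for k
    using member_le_sum[of k "{..k}" "\<lambda>i. \<bar>d i\<bar>"] by (simp add: c_def)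
  show ?thesis
  proof
    show "mono c" unfolding mono_iff_le_Suc by (simp add: c_def)
    show "real k \<le> c k" for k by (simp add: c_def sum_nonneg)
    fix k X x assume X: "X \<in> K" "x \<in> X"
    have "tail_expectation M E (c k) x \<le> (SUP x\<in>X. tail_expectation M E (c k) x)"
      by (rule SUP_upper[OF X(2)])
    also have "\<dots> \<le> ?f (c k)" by (rule SUP_upper[OF X(1)])
    also have "\<dots> < ennreal ((1 / 2) ^ k)" by (rule d) fact
    finally show "tail_expectation M E (c k) x < ennreal ((1 / 2) ^ k)" .
  qed
qed

text \<open>Since \<open>expectation_comp\<close> is an infimum, one representative \<open>y\<close>
  suffices: it must lie in \<open>X\<close>, its composition must be Cauchy, and its expectations
  must stay below 2, the total of the geometric series.\<close>

lemma expectation_comp_ramp_sum_le: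
  assumes X: "X \<in> L1 H E" "x \<in> X"
    and c: "mono c" "\<And>k. real k \<le> c k"
    and tail: "\<And>k. tail_expectation M E (c k) x < ennreal ((1 / 2) ^ k)"
  shows "expectation_comp H E (ramp_sum c) X \<le> ennreal 2"
proof -
  have c0: "0 \<le> c k" for k using c(2)[of k] by linarith
  have x: "x \<in> cauchy_seqs H E" using L1_elements_equivalent(1)[OF X X(2)] .
  then have xH: "x n \<in> H" for n by (simp add: cauchy_seqs_def)
  have "\<forall>\<^sub>F n in sequentially. E (\<lambda>\<omega>. max 0 (\<bar>x n \<omega>\<bar> - c k)) \<le> (1 / 2) ^ k" for k
  proof -
    have "\<forall>\<^sub>F n in sequentially. ennreal (E (\<lambda>\<omega>. \<bar>x n \<omega>\<bar> *
        indicator {\<omega> \<in> space M. \<bar>x n \<omega>\<bar> \<ge> c k} \<omega>)) < ennreal ((1 / 2) ^ k)"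
      using tail[of k] unfolding tail_expectation_def by (rule Limsup_lessD)
    then show ?thesis
    proof eventually_elim
      case (elim n)
      then have "E (\<lambda>\<omega>. \<bar>x n \<omega>\<bar> * indicator {\<omega> \<in> space M. \<bar>x n \<omega>\<bar> \<ge> c k} \<omega>) \<le> (1 / 2) ^ k"
        by (meson ennreal_leI leD linear)
      then show ?case using E_ramp_le_tail[OF xH c0] order_trans by blast
    qed
  qed
  then have "\<forall>\<^sub>F m in sequentially. n \<le> m \<and> (\<forall>k\<in>{..n}. E (\<lambda>\<omega>. max 0 (\<bar>x m \<omega>\<bar> - c k)) \<le> (1 / 2) ^ k)"
    for n
    by (intro eventually_conj eventually_ge_at_top eventually_ball_finite) auto
  then have "\<forall>n. \<exists>m. n \<le> m \<and> (\<forall>k\<le>n. E (\<lambda>\<omega>. max 0 (\<bar>x m \<omega>\<bar> - c k)) \<le> (1 / 2) ^ k)"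
    unfolding eventually_sequentially by blast
  \<comment> \<open>Each ramp bound holds only eventually, from an index that depends on the level.
    The term at \<open>N n\<close> satisfies the bounds for levels \<open>0\<close> to
    \<open>n\<close> at once, and \<open>n \<le> N n\<close> keeps it close to
    \<open>x n\<close>.\<close>
  then obtain N where N: "\<And>n. n \<le> N n"
    and ramp: "\<And>n k. k \<le> n \<Longrightarrow> E (\<lambda>\<omega>. max 0 (\<bar>x (N n) \<omega>\<bar> - c k)) \<le> (1 / 2) ^ k"
    by metis
  define y where "y n \<omega> = trunc (c n) (x (N n) \<omega>)" for n \<omega>
  have yH: "y n \<in> H" for n
    unfolding y_def by (rule H_trunc[OF xH])
  have y_le: "\<bar>y n \<omega>\<bar> \<le> c n" for n \<omega>
    by (simp add: y_def abs_trunc_le c0)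
  have rampH: "(\<lambda>\<omega>. max 0 (\<bar>y n \<omega>\<bar> - c k)) \<in> H" for n k
    by (intro H_max0 H_diff H_abs H_const yH)
  \<comment> \<open>Levels up to \<open>n\<close> are handled by the choice of \<open>N\<close>;
    above them the truncation at \<open>c n\<close> makes the ramp vanish. The bound is therefore
    uniform in \<open>n\<close>.\<close>
  have y_ramp: "E (\<lambda>\<omega>. max 0 (\<bar>y n \<omega>\<bar> - c k)) \<le> (1 / 2) ^ k" for n k
  proof (cases "k \<le> n")
    case True
    have "E (\<lambda>\<omega>. max 0 (\<bar>y n \<omega>\<bar> - c k)) \<le> E (\<lambda>\<omega>. max 0 (\<bar>x (N n) \<omega>\<bar> - c k))"
    proof (rule E_mono[OF _ rampH])
      show "max 0 (\<bar>y n \<omega>\<bar> - c k) \<le> max 0 (\<bar>x (N n) \<omega>\<bar> - c k)" for \<omega>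
        using abs_trunc_le_abs[OF c0, of n "x (N n) \<omega>"] by (simp add: y_def)
    qed (intro H_max0 H_diff H_abs H_const xH)
    with ramp[OF True] show ?thesis by linarith
  next
    case False
    then have "c n \<le> c k" using monoD[OF c(1)] by simp
    then have "max 0 (\<bar>y n \<omega>\<bar> - c k) = 0" for \<omega> using y_le[of n \<omega>] by simp
    then show ?thesis by (simp add: E_const)
  qed
  have y_eq: "(\<lambda>n. E (\<lambda>\<omega>. \<bar>x n \<omega> - y n \<omega>\<bar>)) \<longlonglongrightarrow> 0"
  proof (rule LIMSEQ_I)
    fix r :: real assume r: "0 < r"
    obtain n0 where n0: "\<And>m n. m \<ge> n0 \<Longrightarrow> n \<ge> n0 \<Longrightarrow> E (\<lambda>\<omega>. \<bar>x m \<omega> - x n \<omega>\<bar>) < r / 2"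
      using x half_gt_zero[OF r] unfolding cauchy_seqs_def by blast
    obtain n1 where n1: "(1 / 2 :: real) ^ n1 < r / 2"
      using real_arch_pow_inv[of "r / 2" "1 / 2"] r by auto
    have "norm (E (\<lambda>\<omega>. \<bar>x n \<omega> - y n \<omega>\<bar>) - 0) < r" if n: "n \<ge> max n0 n1" for n
    proof -
      have "E (\<lambda>\<omega>. \<bar>x n \<omega> - y n \<omega>\<bar>) \<le>
          E (\<lambda>\<omega>. \<bar>x n \<omega> - x (N n) \<omega>\<bar>) + E (\<lambda>\<omega>. \<bar>x (N n) \<omega> - y n \<omega>\<bar>)"
        by (rule E_abs_diff_triangle[OF xH xH yH])
      moreover have "E (\<lambda>\<omega>. \<bar>x n \<omega> - x (N n) \<omega>\<bar>) < r / 2"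
        using n N[of n] by (intro n0) auto
      \<comment> \<open>The truncation error is the ramp at level \<open>c n\<close>, hence the case
        \<open>k = n\<close> of the choice of \<open>N\<close>.\<close>
      moreover have "E (\<lambda>\<omega>. \<bar>x (N n) \<omega> - y n \<omega>\<bar>) \<le> (1 / 2) ^ n"
        using ramp[of n n] by (simp add: y_def abs_diff_trunc c0)
      moreover have "(1 / 2 :: real) ^ n \<le> (1 / 2) ^ n1"
        using n by (intro power_decreasing) auto
      moreover have "0 \<le> E (\<lambda>\<omega>. \<bar>x n \<omega> - y n \<omega>\<bar>)"
        by (intro E_nonneg H_abs H_diff xH yH) simp
      ultimately have "\<bar>E (\<lambda>\<omega>. \<bar>x n \<omega> - y n \<omega>\<bar>)\<bar> < r" using n1 by linarith
      then show ?thesis by simp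
    qed
    then show "\<exists>n0. \<forall>n\<ge>n0. norm (E (\<lambda>\<omega>. \<bar>x n \<omega> - y n \<omega>\<bar>) - 0) < r" by blast
  qed
  have y_cauchy: "y \<in> cauchy_seqs H E"
    unfolding cauchy_seqs_def
  proof (intro CollectI conjI allI impI yH)
    fix r :: real assume r: "0 < r"
    then have r4: "0 < r / 4" by simp
    then obtain n0 where n0: "\<And>m n. m \<ge> n0 \<Longrightarrow> n \<ge> n0 \<Longrightarrow> E (\<lambda>\<omega>. \<bar>x m \<omega> - x n \<omega>\<bar>) < r / 4"
      using x unfolding cauchy_seqs_def by blast
    obtain n1 where n1: "\<And>n. n \<ge> n1 \<Longrightarrow> E (\<lambda>\<omega>. \<bar>x n \<omega> - y n \<omega>\<bar>) < r / 4"
      using LIMSEQ_D[OF y_eq r4] by fastforce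
    have "E (\<lambda>\<omega>. \<bar>y m \<omega> - y n \<omega>\<bar>) < r" if "m \<ge> max n0 n1" "n \<ge> max n0 n1" for m n
    proof -
      have "E (\<lambda>\<omega>. \<bar>y m \<omega> - y n \<omega>\<bar>) \<le>
          E (\<lambda>\<omega>. \<bar>x m \<omega> - y m \<omega>\<bar>) + E (\<lambda>\<omega>. \<bar>x m \<omega> - y n \<omega>\<bar>)"
        using E_abs_diff_triangle[of "y m" "x m" "y n"] by (simp add: xH yH abs_minus_commute)
      moreover have "E (\<lambda>\<omega>. \<bar>x m \<omega> - y n \<omega>\<bar>) \<le>
          E (\<lambda>\<omega>. \<bar>x m \<omega> - x n \<omega>\<bar>) + E (\<lambda>\<omega>. \<bar>x n \<omega> - y n \<omega>\<bar>)"
        by (rule E_abs_diff_triangle[OF xH xH yH])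
      ultimately show ?thesis
        using n0[of m n] n1[of m] n1[of n] that r by simp
    qed
    then show "\<exists>n0. \<forall>m\<ge>n0. \<forall>n\<ge>n0. E (\<lambda>\<omega>. \<bar>y m \<omega> - y n \<omega>\<bar>) < r" by blast
  qed
  have yX: "y \<in> X"
  proof -
    obtain z where z: "X = L1_rel H E `` {z}" "z \<in> cauchy_seqs H E"
      using X(1) by (auto simp: L1_def quotient_def)
    have zX: "z \<in> X" using z by (simp add: L1_rel_def E_const)
    have zH: "z n \<in> H" for n using z by (simp add: cauchy_seqs_def)
    have "(\<lambda>n. E (\<lambda>\<omega>. \<bar>z n \<omega> - y n \<omega>\<bar>)) \<longlonglongrightarrow> 0"
    proof (rule tendsto_sandwich[OF _ _ tendsto_const
          tendsto_add_zero[OF L1_elements_equivalent(3)[OF X(1) zX X(2)] y_eq]])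
      show "\<forall>\<^sub>F n in sequentially. 0 \<le> E (\<lambda>\<omega>. \<bar>z n \<omega> - y n \<omega>\<bar>)"
        by (intro always_eventually allI E_nonneg H_abs H_diff zH yH) simp
      show "\<forall>\<^sub>F n in sequentially. E (\<lambda>\<omega>. \<bar>z n \<omega> - y n \<omega>\<bar>) \<le>
          E (\<lambda>\<omega>. \<bar>z n \<omega> - x n \<omega>\<bar>) + E (\<lambda>\<omega>. \<bar>x n \<omega> - y n \<omega>\<bar>)"
        by (intro always_eventually allI E_abs_diff_triangle xH yH zH)
    qed
    then show ?thesis using z y_cauchy by (simp add: L1_rel_def)
  qed
  \<comment> \<open>Any upper limit \<open>m \<ge> n\<close> gives the same sum, so two terms can be
    compared over a common range.\<close>
  have comp: "comp_abs (ramp_sum c) y n = (\<lambda>\<omega>. \<Sum>k<m. max 0 (\<bar>y n \<omega>\<bar> - c k))" if "n \<le> m" for n m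
    unfolding comp_abs_def
    using ramp_sum_eq[OF c(1)] order_trans[OF y_le monoD[OF c(1) that]] by blast
  have compH: "comp_abs (ramp_sum c) y n \<in> H" for n
    unfolding comp[OF order_refl] by (intro H_sum rampH)
  have comp_le: "E (comp_abs (ramp_sum c) y n) \<le> 2" for n
  proof -
    have "E (comp_abs (ramp_sum c) y n) \<le> (\<Sum>k<n. E (\<lambda>\<omega>. max 0 (\<bar>y n \<omega>\<bar> - c k)))"
      unfolding comp[OF order_refl] by (intro E_sum_le rampH)
    also have "\<dots> \<le> (\<Sum>k<n. (1 / 2) ^ k)" by (intro sum_mono y_ramp)
    also have "\<dots> \<le> 2" by (rule sum_half_powers_le) simp
    finally show ?thesis .
  qed
  \<comment> \<open>\<open>\<phi>\<close> is not Lipschitz: use the Lipschitz bound for its first \<open>j\<close> summands and the uniform tail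
    bound for the others.\<close>
  have comp_diff: "E (\<lambda>\<omega>. \<bar>comp_abs (ramp_sum c) y m \<omega> - comp_abs (ramp_sum c) y n \<omega>\<bar>) \<le>
      real j * E (\<lambda>\<omega>. \<bar>y m \<omega> - y n \<omega>\<bar>) + 4 * (1 / 2) ^ j" for m n j
  proof -
    define l where "l = max m n"
    let ?t = "\<lambda>i k \<omega>. max 0 (\<bar>y i \<omega>\<bar> - c k)"
    let ?D = "\<lambda>k \<omega>. \<bar>?t m k \<omega> - ?t n k \<omega>\<bar>"
    have DH: "?D k \<in> H" for k
      by (intro H_abs H_diff rampH)
    have dH: "(\<lambda>\<omega>. \<bar>y m \<omega> - y n \<omega>\<bar>) \<in> H"
      by (intro H_abs H_diff yH)
    have d0: "0 \<le> E (\<lambda>\<omega>. \<bar>y m \<omega> - y n \<omega>\<bar>)"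
      by (rule E_nonneg[OF dH]) simp
    \<comment> \<open>Each ramp is 1-Lipschitz in \<open>\<bar>t\<bar>\<close>, hence in
      \<open>t\<close>.\<close>
    have D1: "E (?D k) \<le> E (\<lambda>\<omega>. \<bar>y m \<omega> - y n \<omega>\<bar>)" for k
      by (rule E_mono[OF dH DH]) linarith
    have D2: "E (?D k) \<le> 2 * (1 / 2) ^ k" for k
    proof -
      have "E (?D k) \<le> E (\<lambda>\<omega>. ?t m k \<omega> + ?t n k \<omega>)"
        by (rule E_mono[OF H_add[OF rampH rampH] DH]) linarith
      also have "\<dots> \<le> E (?t m k) + E (?t n k)" by (rule E_subadd[OF rampH rampH])
      finally show ?thesis using y_ramp[of m k] y_ramp[of n k] by linarith
    qed
    have comps: "comp_abs (ramp_sum c) y m \<omega> = (\<Sum>k<l. ?t m k \<omega>)"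
      "comp_abs (ramp_sum c) y n \<omega> = (\<Sum>k<l. ?t n k \<omega>)" for \<omega>
      by (simp_all add: comp[of _ l] l_def)
    have "E (\<lambda>\<omega>. \<bar>comp_abs (ramp_sum c) y m \<omega> - comp_abs (ramp_sum c) y n \<omega>\<bar>) \<le>
        E (\<lambda>\<omega>. \<Sum>k<l. ?D k \<omega>)"
      by (rule E_mono[OF H_sum[OF DH] H_abs[OF H_diff[OF compH compH]]])
        (simp add: comps sum_subtractf[symmetric] sum_abs)
    also have "\<dots> \<le> (\<Sum>k<l. E (?D k))"
      by (rule E_sum_le[OF DH])
    \<comment> \<open>Lengthening the range by non-negative terms allows a split at \<open>j\<close>
      even when \<open>l < j\<close>.\<close>
    also have "\<dots> \<le> (\<Sum>k<j + l. E (?D k))"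
      by (rule sum_mono2) (auto intro: E_nonneg DH)
    also have "\<dots> = (\<Sum>k<j. E (?D k)) + (\<Sum>k<l. E (?D (k + j)))"
      by (rule sum_lessThan_add)
    also have "\<dots> \<le> (\<Sum>k<j. E (\<lambda>\<omega>. \<bar>y m \<omega> - y n \<omega>\<bar>)) + (\<Sum>k<l. 2 * (1 / 2) ^ (k + j))"
      by (intro add_mono sum_mono D1 D2)
    also have "(\<Sum>k<l. 2 * (1 / 2 :: real) ^ (k + j)) = 2 * (1 / 2) ^ j * (\<Sum>k<l. (1 / 2) ^ k)"
      by (simp add: sum_distrib_left power_add mult_ac)
    also have "\<dots> \<le> 2 * (1 / 2) ^ j * 2"
      by (intro mult_left_mono sum_half_powers_le) auto
    finally show ?thesis by simp
  qed
  have comp_cauchy: "comp_abs (ramp_sum c) y \<in> cauchy_seqs H E"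
    unfolding cauchy_seqs_def
  proof (intro CollectI conjI allI impI compH)
    fix r :: real assume r: "0 < r"
    \<comment> \<open>First \<open>j\<close> is fixed so that the tail term
      \<open>4 * (1 / 2) ^ j\<close> is below \<open>r / 2\<close>; only then are the indices taken
      large enough for the Lipschitz term. The denominator below uses \<open>j + 1\<close> to cover
      \<open>j = 0\<close>.\<close>
    obtain j where j: "(1 / 2 :: real) ^ j < r / 8"
      using real_arch_pow_inv[of "r / 8" "1 / 2"] r by auto
    have "0 < r / (2 * (real j + 1))" using r by simp
    then obtain n0 where n0: "\<And>m n. m \<ge> n0 \<Longrightarrow> n \<ge> n0 \<Longrightarrow>
        E (\<lambda>\<omega>. \<bar>y m \<omega> - y n \<omega>\<bar>) < r / (2 * (real j + 1))"
      using y_cauchy unfolding cauchy_seqs_def by blast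
    have "E (\<lambda>\<omega>. \<bar>comp_abs (ramp_sum c) y m \<omega> - comp_abs (ramp_sum c) y n \<omega>\<bar>) < r"
      if "m \<ge> n0" "n \<ge> n0" for m n
    proof -
      have "real j * E (\<lambda>\<omega>. \<bar>y m \<omega> - y n \<omega>\<bar>) \<le> real j * (r / (2 * (real j + 1)))"
        using n0[OF that] by (intro mult_left_mono) auto
      also have "\<dots> \<le> r / 2" using r by (simp add: field_simps)
      finally show ?thesis using comp_diff[of m n j] j by linarith
    qed
    then show "\<exists>n0. \<forall>m\<ge>n0. \<forall>n\<ge>n0.
        E (\<lambda>\<omega>. \<bar>comp_abs (ramp_sum c) y m \<omega> - comp_abs (ramp_sum c) y n \<omega>\<bar>) < r" by blast
  qed
  have "lim (\<lambda>n. E (comp_abs (ramp_sum c) y n)) \<le> 2"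
    using cauchy_seqs_imp_convergent[OF comp_cauchy] comp_le
    by (intro LIMSEQ_le_const2[of "\<lambda>n. E (comp_abs (ramp_sum c) y n)"])
      (auto simp: convergent_LIMSEQ_iff)
  then have "ennreal (lim (\<lambda>n. E (comp_abs (ramp_sum c) y n))) \<le> ennreal 2"
    by (rule ennreal_leI)
  then show ?thesis
    unfolding expectation_comp_def
    by (intro INF_lower2[of y]) (use yX comp_cauchy in auto)
qed

end

theorem theorem3p2:
  fixes M :: "'a measure" and H :: "('a \<Rightarrow> real) set" and E :: "('a \<Rightarrow> real) \<Rightarrow> real"
    and K :: "(nat \<Rightarrow> 'a \<Rightarrow> real) set set"
  assumes "sublinear_expectation_space M H E"
    and "K \<subseteq> L1 H E"
  shows "uniformly_integrable M E K \<longleftrightarrow>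
    (\<exists>\<phi> :: real \<Rightarrow> real. (\<forall>t\<ge>0. 0 \<le> \<phi> t) \<and> filterlim (\<lambda>t. \<phi> t / t) at_top at_top \<and>
       (SUP X\<in>K. expectation_comp H E \<phi> X) < \<infinity>)"
proof -
  interpret sublinear_expectation_space M H E by fact
  show ?thesis
  proof
    assume "uniformly_integrable M E K"
    then obtain c where c: "mono c" "\<And>k. real k \<le> c k"
      and tail: "\<And>k X x. X \<in> K \<Longrightarrow> x \<in> X \<Longrightarrow> tail_expectation M E (c k) x < ennreal ((1 / 2) ^ k)"
      by (rule uniformly_integrable_levels) blast
    have "expectation_comp H E (ramp_sum c) X \<le> ennreal 2" if X: "X \<in> K" for X
    proof -
      have XL: "X \<in> L1 H E" using X assms(2) by blast
      \<comment> \<open>The class is non-empty: it contains the sequence that generates it.\<close>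
      then obtain x where "x \<in> cauchy_seqs H E" "X = L1_rel H E `` {x}"
        by (auto simp: L1_def quotient_def)
      then have "x \<in> X" by (simp add: L1_rel_def E_const)
      then show ?thesis
        using expectation_comp_ramp_sum_le[OF XL _ c] tail[OF X] by blast
    qed
    then have "(SUP X\<in>K. expectation_comp H E (ramp_sum c) X) \<le> ennreal 2"
      by (rule SUP_least)
    then have "(SUP X\<in>K. expectation_comp H E (ramp_sum c) X) < \<infinity>"
      by (rule le_less_trans) simp
    \<comment> \<open>Comparison with the empty partial sum.\<close>
    moreover have "0 \<le> ramp_sum c t" for t
      using ramp_sum_ge[OF c, where n = 0] by simp
    ultimately show "\<exists>\<phi> :: real \<Rightarrow> real. (\<forall>t\<ge>0. 0 \<le> \<phi> t) \<and> filterlim (\<lambda>t. \<phi> t / t) at_top at_top \<and>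
       (SUP X\<in>K. expectation_comp H E \<phi> X) < \<infinity>"
      using ramp_sum_superlinear[OF c] by blast
  next
    assume "\<exists>\<phi> :: real \<Rightarrow> real. (\<forall>t\<ge>0. 0 \<le> \<phi> t) \<and> filterlim (\<lambda>t. \<phi> t / t) at_top at_top \<and>
       (SUP X\<in>K. expectation_comp H E \<phi> X) < \<infinity>"
    then show "uniformly_integrable M E K"
      using uniformly_integrableI[OF assms(2)] by blast
  qed
qed

end
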